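(* A displacement field $\mathbf{u}:\Omega\to\mathbb{R}^3$ is universal for the orthotropic class $\mathbb{D}_4^h$ of linear strain-gradient elastic solids if and only if it is the superposition (sum) of a homogeneous displacement field and a field of the form $$\bigl(c_1x_2x_3+c_2x_1x_3,\; -c_2x_2x_3+c_3x_1x_3,\; g(x_1,x_2)\bigr),\qquad g(x_1,x_2)=d_1+d_2x_1+d_3x_2+d_4x_1x_2+d_5(x_2^2-x_1^2),$$ for some real constants $c_1,c_2,c_3,d_1,\dots,d_5$.
   Context: $\Omega\subset\mathbb{R}^3$ is a nonempty convex open set with Cartesian coordinates $(x_1,x_2,x_3)$ and orthonormal basis $e_1,e_2,e_3$. Repeated indices are summed over $1,2,3$ and a comma denotes partial differentiation. A displacement field is a smooth map $\mathbf{u}:\Omega\to\mathbb{R}^3$, with strain $e_{lm}=\tfrac12(u_{l,m}+u_{m,l})$. It is homogeneous if $\mathbf{u}(\mathbf{x})=\mathbf{H}\mathbf{x}+\mathbf{b}$ for a constant matrix $\mathbf{H}$ and constant vector $\mathbf{b}$. A strain-gradient material is a triple $(\mathsf{C},\mathsf{M},\mathsf{A})$ of constant real tensors of orders $4,5,6$ with index symmetries $\mathsf{C}_{ijlm}=\mathsf{C}_{jilm}=\mathsf{C}_{lmij}$, $\mathsf{M}_{ijklm}=\mathsf{M}_{jiklm}=\mathsf{M}_{ijlkm}$, $\mathsf{A}_{ijklmn}=\mathsf{A}_{jiklmn}=\mathsf{A}_{lmnijk}$. Its stress and hyper-stress are $\sigma_{ij}=\mathsf{C}_{ijlm}e_{lm}+\mathsf{M}_{ijlmn}e_{lm,n}$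 and $\tau_{ijk}=\mathsf{M}_{lmijk}e_{lm}+\mathsf{A}_{ijklmn}e_{lm,n}$, and the equilibrium equations without body forces are $\sigma_{ij,j}-\tau_{ijk,jk}=0$ in $\Omega$ for $i=1,2,3$. For a subgroup $G\subset \mathrm{O}(3)$, a tensor $T$ of order $p$ is $G$-invariant if $Q_{i_1j_1}\cdots Q_{i_pj_p}T_{j_1\dots j_p}=T_{i_1\dots i_p}$ for all $Q\in G$. Let $R$ be the rotation by $\pi/2$ about $e_3$. $\mathbb{D}_4$ is generated by $R$ and the rotation by $\pi$ about $e_1$; $\mathbb{D}_4^h$ is generated by $-R$ and the reflection $x_1\mapsto -x_1$; $\mathbb{Z}_2^c=\{I,-I\}$, and $\mathbb{D}_4\oplus\mathbb{Z}_2^c$ is the group generated by $\mathbb{D}_4$ and $-I$. The class $\mathbb{D}_4^h$ is the set of all materials with $\mathsf{C}$ and $\mathsf{A}$ $\mathbb{D}_4\oplus\mathbb{Z}_2^c$-invariant (6 and 28 independent constants) and $\mathsf{M}$ $\mathbb{D}_4^h$-invariant (13 independent constants). A displacement field is universal for the class if it satisfies the equilibrium equations for every material in the class. *)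

theory Defs
  imports "HOL-Analysis.Analysis" "HOL-Algebra.Generated_Groups"
begin

section \<open>Smooth fields on open subsets of three-dimensional space\<close>

text \<open>The partial derivative \<open>f\<^sub>,\<^sub>i\<close>, expressed through the Frechet derivative. It is used
  only at points where the function is differentiable.\<close>

definition partial :: "3 \<Rightarrow> (real^3 \<Rightarrow> 'a::real_normed_vector) \<Rightarrow> real^3 \<Rightarrow> 'a" where
  "partial i f x = frechet_derivative f (at x) (axis i 1)"

primrec Ck_on :: "nat \<Rightarrow> (real^3) set \<Rightarrow> (real^3 \<Rightarrow> 'a::real_normed_vector) \<Rightarrow> bool" where
  "Ck_on 0 S f \<longleftrightarrow> continuous_on S f"
| "Ck_on (Suc k) S f \<longleftrightarrow> (\<forall>x\<in>S. f differentiable (at x)) \<and> (\<forall>i. Ck_on k S (partial i f))"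

definition smooth_on :: "(real^3) set \<Rightarrow> (real^3 \<Rightarrow> 'a::real_normed_vector) \<Rightarrow> bool" where
  "smooth_on S f \<longleftrightarrow> (\<forall>k. Ck_on k S f)"

text \<open>Displacement fields are total functions here; only their values on \<open>\<Omega>\<close> matter.\<close>

definition homogeneous_on :: "(real^3) set \<Rightarrow> (real^3 \<Rightarrow> real^3) \<Rightarrow> bool" where
  "homogeneous_on \<Omega> u \<longleftrightarrow> (\<exists>(H::real^3^3) (b::real^3). \<forall>x\<in>\<Omega>. u x = H *v x + b)"

section \<open>Strain-gradient materials\<close>

text \<open>Tensors are given by their Cartesian components; in the index type \<open>3\<close> the third index
  is \<open>3 = 0\<close>.\<close>

type_synonym tensor4 = "3 \<Rightarrow> 3 \<Rightarrow> 3 \<Rightarrow> 3 \<Rightarrow> real"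
type_synonym tensor5 = "3 \<Rightarrow> 3 \<Rightarrow> 3 \<Rightarrow> 3 \<Rightarrow> 3 \<Rightarrow> real"
type_synonym tensor6 = "3 \<Rightarrow> 3 \<Rightarrow> 3 \<Rightarrow> 3 \<Rightarrow> 3 \<Rightarrow> 3 \<Rightarrow> real"

record sg_tensors =
  Cten :: tensor4
  Mten :: tensor5
  Aten :: tensor6

definition sg_material :: "sg_tensors \<Rightarrow> bool" where
  "sg_material m \<longleftrightarrow>
     (\<forall>i j k l. Cten m i j k l = Cten m j i k l \<and> Cten m i j k l = Cten m k l i j) \<and>
     (\<forall>i j k l n. Mten m i j k l n = Mten m j i k l n \<and> Mten m i j k l n = Mten m i j l k n) \<and>
     (\<forall>i j k l n p. Aten m i j k l n p = Aten m j i k l n p \<and>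
                    Aten m i j k l n p = Aten m l n p i j k)"

definition strain :: "(real^3 \<Rightarrow> real^3) \<Rightarrow> 3 \<Rightarrow> 3 \<Rightarrow> real^3 \<Rightarrow> real" where
  "strain u l m x = (partial m (\<lambda>y. u y $ l) x + partial l (\<lambda>y. u y $ m) x) / 2"

definition stress :: "sg_tensors \<Rightarrow> (real^3 \<Rightarrow> real^3) \<Rightarrow> 3 \<Rightarrow> 3 \<Rightarrow> real^3 \<Rightarrow> real" where
  "stress mtl u i j x =
     (\<Sum>l\<in>UNIV. \<Sum>m\<in>UNIV. Cten mtl i j l m * strain u l m x) +
     (\<Sum>l\<in>UNIV. \<Sum>m\<in>UNIV. \<Sum>n\<in>UNIV. Mten mtl i j l m n * partial n (strain u l m) x)"

definition hyper_stress :: "sg_tensors \<Rightarrow> (real^3 \<Rightarrow> real^3) \<Rightarrow> 3 \<Rightarrow> 3 \<Rightarrow> 3 \<Rightarrow> real^3 \<Rightarrow> real" where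
  "hyper_stress mtl u i j k x =
     (\<Sum>l\<in>UNIV. \<Sum>m\<in>UNIV. Mten mtl l m i j k * strain u l m x) +
     (\<Sum>l\<in>UNIV. \<Sum>m\<in>UNIV. \<Sum>n\<in>UNIV. Aten mtl i j k l m n * partial n (strain u l m) x)"

definition equilibrium_on :: "(real^3) set \<Rightarrow> sg_tensors \<Rightarrow> (real^3 \<Rightarrow> real^3) \<Rightarrow> bool" where
  "equilibrium_on \<Omega> mtl u \<longleftrightarrow>
     (\<forall>x\<in>\<Omega>. \<forall>i.
        (\<Sum>j\<in>UNIV. partial j (stress mtl u i j) x) -
        (\<Sum>j\<in>UNIV. \<Sum>k\<in>UNIV. partial k (partial j (hyper_stress mtl u i j k)) x) = 0)"

definition universal_on ::
    "(real^3) set \<Rightarrow> sg_tensors set \<Rightarrow> (real^3 \<Rightarrow> real^3) \<Rightarrow> bool" where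
  "universal_on \<Omega> K u \<longleftrightarrow> (\<forall>mtl\<in>K. equilibrium_on \<Omega> mtl u)"

section \<open>Material symmetry\<close>

definition O3 :: "(real^3^3) monoid" where
  "O3 = \<lparr>carrier = {Q. orthogonal_matrix Q}, mult = (**), one = mat 1\<rparr>"

lemma group_O3: "group O3"
proof (rule groupI)
  fix Q :: "real^3^3"
  assume "Q \<in> carrier O3"
  then show "\<exists>P\<in>carrier O3. P \<otimes>\<^bsub>O3\<^esub> Q = \<one>\<^bsub>O3\<^esub>"
    by (intro bexI[of _ "transpose Q"]) (auto simp: O3_def orthogonal_matrix_def)
qed (auto simp: O3_def orthogonal_matrix_mul orthogonal_matrix_id matrix_mul_assoc)

definition invariant4 :: "(real^3^3) set \<Rightarrow> tensor4 \<Rightarrow> bool" where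
  "invariant4 G T \<longleftrightarrow> (\<forall>Q\<in>G. \<forall>i j k l.
     (\<Sum>a\<in>UNIV. \<Sum>b\<in>UNIV. \<Sum>c\<in>UNIV. \<Sum>d\<in>UNIV.
        Q$i$a * Q$j$b * Q$k$c * Q$l$d * T a b c d) = T i j k l)"

definition invariant5 :: "(real^3^3) set \<Rightarrow> tensor5 \<Rightarrow> bool" where
  "invariant5 G T \<longleftrightarrow> (\<forall>Q\<in>G. \<forall>i j k l m.
     (\<Sum>a\<in>UNIV. \<Sum>b\<in>UNIV. \<Sum>c\<in>UNIV. \<Sum>d\<in>UNIV. \<Sum>e\<in>UNIV.
        Q$i$a * Q$j$b * Q$k$c * Q$l$d * Q$m$e * T a b c d e) = T i j k l m)"

definition invariant6 :: "(real^3^3) set \<Rightarrow> tensor6 \<Rightarrow> bool" where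
  "invariant6 G T \<longleftrightarrow> (\<forall>Q\<in>G. \<forall>i j k l m n.
     (\<Sum>a\<in>UNIV. \<Sum>b\<in>UNIV. \<Sum>c\<in>UNIV. \<Sum>d\<in>UNIV. \<Sum>e\<in>UNIV. \<Sum>f\<in>UNIV.
        Q$i$a * Q$j$b * Q$k$c * Q$l$d * Q$m$e * Q$n$f * T a b c d e f) = T i j k l m n)"

text \<open>Matrices are listed by rows and act on column vectors; \<open>rot_e3\<close> maps \<open>e\<^sub>1\<close> to \<open>e\<^sub>2\<close>.\<close>

definition rot_e3 :: "real^3^3" \<comment> \<open>rotation by \<open>\<pi>/2\<close> about \<open>e\<^sub>3\<close>\<close> where
  "rot_e3 = vector [vector [0, -1, 0], vector [1, 0, 0], vector [0, 0, 1]]"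

definition rot_e1 :: "real^3^3" \<comment> \<open>rotation by \<open>\<pi>\<close> about \<open>e\<^sub>1\<close>\<close> where
  "rot_e1 = vector [vector [1, 0, 0], vector [0, -1, 0], vector [0, 0, -1]]"

definition refl_e1 :: "real^3^3" \<comment> \<open>reflection \<open>x\<^sub>1 \<mapsto> -x\<^sub>1\<close>\<close> where
  "refl_e1 = vector [vector [-1, 0, 0], vector [0, 1, 0], vector [0, 0, 1]]"

lemma generators_in_O3:
  "rot_e3 \<in> carrier O3" "- rot_e3 \<in> carrier O3" "rot_e1 \<in> carrier O3" "refl_e1 \<in> carrier O3"
  "- mat 1 \<in> carrier O3"
  by (auto simp: O3_def orthogonal_matrix_def rot_e3_def rot_e1_def refl_e1_def vec_eq_iff
      forall_3 matrix_matrix_mult_def transpose_def sum_3 mat_def)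

definition D4 :: "(real^3^3) set" where
  "D4 = generate O3 {rot_e3, rot_e1}"

definition D4h :: "(real^3^3) set" where
  "D4h = generate O3 {- rot_e3, refl_e1}"

definition D4_Z2c :: "(real^3^3) set" where
  "D4_Z2c = generate O3 (D4 \<union> {- mat 1})"

definition class_D4h :: "sg_tensors set" where
  "class_D4h = {m. sg_material m \<and>
     invariant4 D4_Z2c (Cten m) \<and> invariant5 D4h (Mten m) \<and> invariant6 D4_Z2c (Aten m)}"

end

theory Submission
  imports Defs
begin

text \<open>
  Taking \<open>M = 0\<close> and \<open>A = 0\<close> and varying the six constants of \<open>C\<close> shows that all second partial
  derivatives of a universal field vanish, except for \<open>u\<^sub>1\<^sub>,\<^sub>1\<^sub>3 = - u\<^sub>2\<^sub>,\<^sub>2\<^sub>3\<close>, \<open>u\<^sub>1\<^sub>,\<^sub>2\<^sub>3\<close>, \<open>u\<^sub>2\<^sub>,\<^sub>1\<^sub>3\<close>,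
  \<open>u\<^sub>3\<^sub>,\<^sub>1\<^sub>2\<close> and \<open>u\<^sub>3\<^sub>,\<^sub>1\<^sub>1 = - u\<^sub>3\<^sub>,\<^sub>2\<^sub>2\<close>. Hence all third partial derivatives of \<open>u\<^sub>1\<close> and \<open>u\<^sub>2\<close> vanish,
  and \<open>u\<^sub>3\<close> is, up to a term linear in \<open>x\<^sub>3\<close>, a harmonic function of \<open>x\<^sub>1\<close> and \<open>x\<^sub>2\<close>. A single tensor \<open>M\<close>
  of the class, with \<open>M\<^sub>1\<^sub>1\<^sub>1\<^sub>3\<^sub>1 = - M\<^sub>2\<^sub>2\<^sub>2\<^sub>3\<^sub>2\<close>, then forces \<open>u\<^sub>3\<^sub>,\<^sub>1\<^sub>1\<^sub>1 = u\<^sub>3\<^sub>,\<^sub>2\<^sub>2\<^sub>2 = 0\<close>, so by harmonicity the third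
  partial derivatives of \<open>u\<^sub>3\<close> vanish as well and \<open>u\<close> is quadratic. Conversely, \<open>M\<close> and \<open>A\<close> do not act on
  quadratic fields in the equilibrium equations, and the terms with \<open>C\<close> cancel by its invariance under
  \<open>R\<close> and the rotation by \<open>\<pi>\<close> about \<open>e\<^sub>1\<close>.
\<close>

section \<open>Partial derivatives\<close>

lemma partial_eqI:
  assumes "(f has_derivative f') (at x)"
  shows "partial i f x = f' (axis i 1)"
  using frechet_derivative_at[OF assms] by (simp add: partial_def)

text \<open>A linear map is determined by its values on the standard basis, and for the Frechet
  derivative these values are the partial derivatives.\<close>

lemma has_derivative_partial:
  assumes "f differentiable (at x)"
  shows "(f has_derivative (\<lambda>h. \<Sum>i\<in>UNIV. h $ i *\<^sub>R partial i f x)) (at x)"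
proof -
  let ?D = "frechet_derivative f (at x)"
  have D: "(f has_derivative ?D) (at x)"
    using assms frechet_derivative_works by blast
  then have lin: "linear ?D"
    by (rule has_derivative_linear)
  have "?D h = (\<Sum>i\<in>UNIV. h $ i *\<^sub>R partial i f x)" for h
  proof -
    have "?D h = ?D (\<Sum>i\<in>UNIV. h $ i *s axis i 1)"
      by (simp only: basis_expansion)
    also have "\<dots> = (\<Sum>i\<in>UNIV. h $ i *\<^sub>R partial i f x)"
      by (simp add: linear_sum[OF lin] linear_scale[OF lin] scalar_mult_eq_scaleR partial_def)
    finally show ?thesis .
  qed
  then have "?D = (\<lambda>h. \<Sum>i\<in>UNIV. h $ i *\<^sub>R partial i f x)" ..
  then show ?thesis using D by simp
qed

section \<open>Locality of derivatives and passage to components\<close>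

text \<open>The two functions have exactly the same derivatives at \<open>x\<close>, so the choice
  operator behind \<open>frechet_derivative\<close> selects the same map for both, even at a point
  where no derivative exists.\<close>

lemma partial_cong:
  assumes "open S" "x \<in> S" "\<And>y. y \<in> S \<Longrightarrow> f y = g y"
  shows "partial i f x = partial i g x"
proof -
  have "(f has_derivative f') (at x) \<longleftrightarrow> (g has_derivative f') (at x)" for f'
    using has_derivative_transform_within_open[OF _ assms(1,2), of f f' UNIV g]
      has_derivative_transform_within_open[OF _ assms(1,2), of g f' UNIV f] assms(3) by auto
  then show ?thesis
    by (simp add: partial_def frechet_derivative_def)
qed

lemma differentiable_cong_open:
  assumes "open S" "x \<in> S" "\<And>y. y \<in> S \<Longrightarrow> f y = g y" "f differentiable (at x)"
  shows "g differentiable (at x)"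
  using assms has_derivative_transform_within_open[of f _ x UNIV S g]
  unfolding differentiable_def by metis

text \<open>Formulas for partial derivatives hold only on \<open>S\<close>, not as equations between
  total functions. This congruence lets the inductions on \<open>k\<close> work with such
  formulas.\<close>

lemma Ck_on_cong:
  assumes "open S" "Ck_on k S f" "\<And>y. y \<in> S \<Longrightarrow> f y = g y"
  shows "Ck_on k S g"
  using assms(2,3)
proof (induction k arbitrary: f g)
  case 0
  have "continuous_on S g"
    by (rule continuous_on_eq[of S f]) (use 0 in simp_all)
  then show ?case by simp
next
  case (Suc k)
  have fg: "f y = g y" if "y \<in> S" for y
    using Suc.prems(2) that .
  have "Ck_on k S (partial i g)" for i
  proof (rule Suc.IH)
    show "Ck_on k S (partial i f)" using Suc.prems(1) by simp
    show "partial i f y = partial i g y" if "y \<in> S" for y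
      by (rule partial_cong[OF assms(1) that fg])
  qed
  moreover have "g differentiable (at x)" if "x \<in> S" for x
    by (rule differentiable_cong_open[OF assms(1) that fg]) (use Suc.prems(1) that in simp_all)
  ultimately show ?case by simp
qed

lemma partial_component:
  fixes u :: "real^3 \<Rightarrow> real^3"
  assumes "u differentiable (at x)"
  shows "partial i (\<lambda>y. u y $ l) x = partial i u x $ l"
proof -
  have "(u has_derivative frechet_derivative u (at x)) (at x)"
    using assms frechet_derivative_works by blast
  from bounded_linear.has_derivative[OF bounded_linear_vec_nth[of l] this]
  show ?thesis
    by (subst partial_eqI) (simp_all add: partial_def)
qed

lemma Ck_on_component:
  fixes u :: "real^3 \<Rightarrow> real^3"
  assumes "open S" "Ck_on k S u"
  shows "Ck_on k S (\<lambda>y. u y $ l)"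
  using assms(2)
proof (induction k arbitrary: u)
  case 0
  then show ?case by (auto intro: continuous_on_component)
next
  case (Suc k)
  have "Ck_on k S (partial i (\<lambda>y. u y $ l))" for i
  proof (rule Ck_on_cong[OF assms(1)])
    show "Ck_on k S (\<lambda>y. partial i u y $ l)"
      by (rule Suc.IH) (use Suc.prems in simp)
    show "partial i u y $ l = partial i (\<lambda>y. u y $ l) y" if "y \<in> S" for y
      by (rule partial_component[symmetric]) (use Suc.prems that in simp)
  qed
  moreover have "(\<lambda>y. u y $ l) differentiable (at x)" if "x \<in> S" for x
  proof -
    have "u differentiable (at x)"
      using Suc.prems that by simp
    then obtain u' where "(u has_derivative u') (at x)"
      unfolding differentiable_def by blast
    from bounded_linear.has_derivative[OF bounded_linear_vec_nth[of l] this]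
    show ?thesis unfolding differentiable_def by blast
  qed
  ultimately show ?case by simp
qed

lemma smooth_on_component:
  fixes u :: "real^3 \<Rightarrow> real^3"
  assumes "open S" "smooth_on S u"
  shows "smooth_on S (\<lambda>y. u y $ l)"
  using assms Ck_on_component unfolding smooth_on_def by blast

lemma smooth_on_partial: "smooth_on S f \<Longrightarrow> smooth_on S (partial i f)"
  using Ck_on.simps(2) unfolding smooth_on_def by blast

lemma smooth_on_differentiable: "smooth_on S f \<Longrightarrow> x \<in> S \<Longrightarrow> f differentiable (at x)"
  using Ck_on.simps(2)[of 0 S f] unfolding smooth_on_def by blast

lemma smooth_on_continuous: "smooth_on S f \<Longrightarrow> continuous_on S f"
  using Ck_on.simps(1)[of S f] unfolding smooth_on_def by blast

text \<open>The left-hand side is symmetric in the directions \<open>i\<close> and \<open>j\<close>, whence the symmetry of the mixed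
  partial derivatives as \<open>t\<close> tends to zero.\<close>

lemma second_difference:
  fixes f :: "real^3 \<Rightarrow> real"
  assumes f: "smooth_on S f" and S: "ball x r \<subseteq> S" and t: "0 < t" "2 * t < r"
  shows "\<exists>z. dist z x \<le> 2 * t \<and> f (x + t *\<^sub>R axis i 1 + t *\<^sub>R axis j 1) - f (x + t *\<^sub>R axis i 1)
     - f (x + t *\<^sub>R axis j 1) + f x = t * t * partial j (partial i f) z"
proof -
  let ?p = "\<lambda>a b. x + a *\<^sub>R axis i 1 + b *\<^sub>R axis j (1::real)"
  have near: "dist (?p a b) x \<le> 2 * t" if "0 \<le> a" "0 \<le> b" "a \<le> t" "b \<le> t" for a b
  proof -
    have "norm (a *\<^sub>R axis i 1 + b *\<^sub>R axis j (1::real)) \<le> a + b"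
      using norm_triangle_ineq[of "a *\<^sub>R axis i 1" "b *\<^sub>R axis j (1::real)"] that by simp
    then show ?thesis using that by (simp add: dist_norm add.assoc)
  qed
  have inS: "?p a b \<in> S" if "0 \<le> a" "0 \<le> b" "a \<le> t" "b \<le> t" for a b
  proof -
    have "?p a b \<in> ball x r"
      using near[OF that] t by (simp add: dist_commute)
    then show ?thesis using S by blast
  qed
  have D: "((\<lambda>s. g (y + s *\<^sub>R axis k 1)) has_real_derivative partial k g (y + s *\<^sub>R axis k 1)) (at s)"
    if "smooth_on S g" "y + s *\<^sub>R axis k 1 \<in> S" for g :: "real^3 \<Rightarrow> real" and y k s
  proof -
    let ?D = "frechet_derivative g (at (y + s *\<^sub>R axis k 1))"
    have g: "g differentiable (at (y + s *\<^sub>R axis k 1))"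
      using smooth_on_differentiable that by blast
    have "((\<lambda>s. y + s *\<^sub>R axis k 1) has_derivative (\<lambda>h. h *\<^sub>R axis k 1)) (at s)"
      by (auto intro!: derivative_eq_intros)
    moreover have "(g has_derivative ?D) (at (y + s *\<^sub>R axis k 1))"
      using g frechet_derivative_works by blast
    ultimately have "((\<lambda>s. g (y + s *\<^sub>R axis k 1)) has_derivative (\<lambda>h. ?D (h *\<^sub>R axis k 1))) (at s)"
      by (rule has_derivative_compose)
    moreover have "?D (h *\<^sub>R axis k 1) = partial k g (y + s *\<^sub>R axis k 1) * h" for h
      using linear_scale[OF linear_frechet_derivative[OF g], of h "axis k 1"]
      by (simp add: partial_def)
    ultimately show ?thesis
      by (simp add: has_field_derivative_def)
  qed
  \<comment> \<open>The mean value theorem is applied twice: first in direction \<open>i\<close> to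
    the increment of \<open>f\<close> along direction \<open>j\<close>, then in direction
    \<open>j\<close> to the resulting increment of \<open>partial i f\<close>.\<close>
  have "((\<lambda>a. f (?p a t) - f (?p a 0)) has_real_derivative
      partial i f (?p a t) - partial i f (?p a 0)) (at a)" if "0 \<le> a" "a \<le> t" for a
  proof (rule DERIV_diff)
    have swap: "x + t *\<^sub>R axis j 1 + s *\<^sub>R axis i 1 = ?p s t" for s
      by (metis add.assoc add.commute)
    show "((\<lambda>a. f (?p a t)) has_real_derivative partial i f (?p a t)) (at a)"
      using D[OF f, of "x + t *\<^sub>R axis j 1" a i] inS[of a t] t that unfolding swap by simp
    show "((\<lambda>a. f (?p a 0)) has_real_derivative partial i f (?p a 0)) (at a)"
      using D[OF f, of x a i] inS[of a 0] t that by simp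
  qed
  from MVT2[OF t(1) this] obtain a where a: "0 < a" "a < t"
    "(f (?p t t) - f (?p t 0)) - (f (?p 0 t) - f (?p 0 0)) =
      (t - 0) * (partial i f (?p a t) - partial i f (?p a 0))"
    by blast
  have "((\<lambda>b. partial i f (?p a b)) has_real_derivative partial j (partial i f) (?p a b)) (at b)"
    if "0 \<le> b" "b \<le> t" for b
    using D[OF smooth_on_partial[OF f, of i], of "x + a *\<^sub>R axis i 1" b j] inS[of a b] a that by simp
  from MVT2[OF t(1) this] obtain b where b: "0 < b" "b < t"
    "partial i f (?p a t) - partial i f (?p a 0) = (t - 0) * partial j (partial i f) (?p a b)"
    by blast
  show ?thesis
  proof (intro exI conjI)
    show "dist (?p a b) x \<le> 2 * t"
      using a b by (intro near; simp)
    have "f (?p t t) - f (?p t 0) - f (?p 0 t) + f (?p 0 0) = t * (t * partial j (partial i f) (?p a b))"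
      using a(3) unfolding b(3) by simp
    then show "f (?p t t) - f (x + t *\<^sub>R axis i 1) - f (x + t *\<^sub>R axis j 1) + f x
        = t * t * partial j (partial i f) (?p a b)"
      by simp
  qed
qed

lemma partial_commute:
  fixes f :: "real^3 \<Rightarrow> real"
  assumes f: "smooth_on S f" and "open S" "x \<in> S"
  shows "partial j (partial i f) x = partial i (partial j f) x"
proof -
  obtain r where r: "r > 0" "ball x r \<subseteq> S"
    using assms openE by blast
  \<comment> \<open>Starting at \<open>r / 4\<close> keeps \<open>2 * t n\<close> strictly below
    \<open>r\<close>, so each second difference is taken inside the ball.\<close>
  define t where "t n = r / 4 / real (Suc n)" for n
  have t: "0 < t n" "2 * t n < r" for n
  proof -
    have "t n \<le> r / 4"
      using r by (simp add: t_def divide_le_eq)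
    then show "2 * t n < r" using r by linarith
  qed (use r in \<open>simp add: t_def\<close>)
  have t0: "t \<longlonglongrightarrow> 0"
    unfolding t_def by (rule LIMSEQ_Suc, rule lim_const_over_n)
  have lim: "(\<lambda>n. F (z n)) \<longlonglongrightarrow> F x"
    if F: "smooth_on S F" and z: "\<And>n. dist (z n) x \<le> 2 * t n" for F :: "real^3 \<Rightarrow> real" and z
  proof -
    have "(\<lambda>n. dist (z n) x) \<longlonglongrightarrow> 0"
    proof (rule Lim_null_comparison)
      show "\<forall>\<^sub>F n in sequentially. norm (dist (z n) x) \<le> 2 * t n"
        by (simp add: z)
      show "(\<lambda>n. 2 * t n) \<longlonglongrightarrow> 0"
        using t0 by (rule tendsto_mult_right_zero)
    qed
    then have "z \<longlonglongrightarrow> x"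
      by (rule tendsto_dist_iff[THEN iffD2])
    moreover have "isCont F x"
      using smooth_on_continuous[OF F] assms by (simp add: continuous_on_eq_continuous_at)
    ultimately show ?thesis
      by (rule isCont_tendsto_compose[rotated])
  qed
  obtain z where z: "\<And>n. dist (z n) x \<le> 2 * t n"
    "\<And>n. f (x + t n *\<^sub>R axis i 1 + t n *\<^sub>R axis j 1) - f (x + t n *\<^sub>R axis i 1)
     - f (x + t n *\<^sub>R axis j 1) + f x = t n * t n * partial j (partial i f) (z n)"
    using second_difference[OF f r(2) t, where i = i and j = j] by metis
  obtain w where w: "\<And>n. dist (w n) x \<le> 2 * t n"
    "\<And>n. f (x + t n *\<^sub>R axis j 1 + t n *\<^sub>R axis i 1) - f (x + t n *\<^sub>R axis j 1)
     - f (x + t n *\<^sub>R axis i 1) + f x = t n * t n * partial i (partial j f) (w n)"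
    using second_difference[OF f r(2) t, where i = j and j = i] by metis
  \<comment> \<open>Both sides equal the same second difference, with the roles of the two axes
    exchanged; the positive factor can then be cancelled.\<close>
  have "t n * t n * partial j (partial i f) (z n) = t n * t n * partial i (partial j f) (w n)" for n
    unfolding z(2)[symmetric] w(2)[symmetric] by (simp add: add_ac)
  then have eq: "partial j (partial i f) (z n) = partial i (partial j f) (w n)" for n
    using t(1)[of n] by (metis less_irrefl mult_eq_0_iff mult_left_cancel)
  have "(\<lambda>n. partial j (partial i f) (z n)) \<longlonglongrightarrow> partial j (partial i f) x"
    by (rule lim[OF smooth_on_partial[OF smooth_on_partial[OF f]] z(1)])
  moreover have "(\<lambda>n. partial j (partial i f) (z n)) \<longlonglongrightarrow> partial i (partial j f) x"
    unfolding eq by (rule lim[OF smooth_on_partial[OF smooth_on_partial[OF f]] w(1)])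
  ultimately show ?thesis
    by (rule LIMSEQ_unique)
qed

section \<open>Recovering polynomials from their partial derivatives\<close>

text \<open>The product rule gives two sums that coincide by the symmetry of \<open>k\<close>, which
  cancels the factor 1/2. Thus \<open>k\<close> is the matrix of second partial derivatives.\<close>

lemma has_derivative_quadratic:
  fixes k :: "3 \<Rightarrow> 3 \<Rightarrow> real"
  assumes sym: "\<And>a b. k a b = k b a"
  shows "((\<lambda>y. c + (\<Sum>a\<in>UNIV. h a * y $ a) + (\<Sum>a\<in>UNIV. \<Sum>b\<in>UNIV. k a b * y $ a * y $ b) / 2)
    has_derivative (\<lambda>d. \<Sum>a\<in>UNIV. (h a + (\<Sum>b\<in>UNIV. k a b * x $ b)) * d $ a)) (at x)"
proof -
  have nth: "((\<lambda>y. y $ a) has_derivative (\<lambda>d. d $ a)) (at x)" for a :: 3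
    by (rule bounded_linear_imp_has_derivative[OF bounded_linear_vec_nth])
  have "((\<lambda>y. c + (\<Sum>a\<in>UNIV. h a * y $ a) + (\<Sum>a\<in>UNIV. \<Sum>b\<in>UNIV. k a b * y $ a * y $ b) / 2)
    has_derivative (\<lambda>d. (\<Sum>a\<in>UNIV. h a * d $ a) +
      (\<Sum>a\<in>UNIV. \<Sum>b\<in>UNIV. k a b * x $ a * d $ b + k a b * d $ a * x $ b) / 2)) (at x)"
    by (auto intro!: derivative_eq_intros nth simp: algebra_simps)
  moreover have "(\<Sum>a\<in>UNIV. h a * d $ a) +
      (\<Sum>a\<in>UNIV. \<Sum>b\<in>UNIV. k a b * x $ a * d $ b + k a b * d $ a * x $ b) / 2 =
      (\<Sum>a\<in>UNIV. (h a + (\<Sum>b\<in>UNIV. k a b * x $ b)) * d $ a)" for d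
    using sym[of 1 2] sym[of 1 3] sym[of 2 3]
    by (simp add: sum_3 field_simps)
  ultimately show ?thesis by simp
qed

lemma partial_quadratic:
  fixes k :: "3 \<Rightarrow> 3 \<Rightarrow> real"
  assumes "open S" "x \<in> S" and sym: "\<And>a b. k a b = k b a"
    and "\<And>y. y \<in> S \<Longrightarrow>
      f y = c + (\<Sum>a\<in>UNIV. h a * y $ a) + (\<Sum>a\<in>UNIV. \<Sum>b\<in>UNIV. k a b * y $ a * y $ b) / 2"
  shows "partial i f x = h i + (\<Sum>b\<in>UNIV. k i b * x $ b)"
proof -
  let ?q = "\<lambda>y. c + (\<Sum>a\<in>UNIV. h a * y $ a) + (\<Sum>a\<in>UNIV. \<Sum>b\<in>UNIV. k a b * y $ a * y $ b) / 2"
  have "partial i f x = partial i ?q x"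
    by (rule partial_cong[OF assms(1,2)]) (rule assms(4))
  also have "\<dots> = h i + (\<Sum>b\<in>UNIV. k i b * x $ b)"
    by (subst partial_eqI[OF has_derivative_quadratic[of k, OF sym]])
      (simp add: axis_def if_distrib cong: if_cong)
  finally show ?thesis .
qed

lemma partial_affine:
  fixes f :: "real^3 \<Rightarrow> real"
  assumes "open S" "x \<in> S" "\<And>y. y \<in> S \<Longrightarrow> f y = c + (\<Sum>a\<in>UNIV. h a * y $ a)"
  shows "partial i f x = h i"
  using partial_quadratic[of S x "\<lambda>_ _. 0" f c h i] assms by simp

text \<open>The difference between \<open>f\<close> and the candidate polynomial has zero
  derivative, hence is constant on the convex set \<open>S\<close>.\<close>

lemma quadratic_if_partials_affine:
  fixes f :: "real^3 \<Rightarrow> real"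
  assumes "open S" "convex S" "smooth_on S f" and sym: "\<And>a b. k a b = k b a"
    and df: "\<And>x i. x \<in> S \<Longrightarrow> partial i f x = h i + (\<Sum>b\<in>UNIV. k i b * x $ b)"
  shows "\<exists>c. \<forall>y\<in>S. f y =
    c + (\<Sum>a\<in>UNIV. h a * y $ a) + (\<Sum>a\<in>UNIV. \<Sum>b\<in>UNIV. k a b * y $ a * y $ b) / 2"
proof -
  let ?q = "\<lambda>y. 0 + (\<Sum>a\<in>UNIV. h a * y $ a) + (\<Sum>a\<in>UNIV. \<Sum>b\<in>UNIV. k a b * y $ a * y $ b) / 2"
  have "((\<lambda>y. f y - ?q y) has_derivative (\<lambda>d. 0)) (at x within S)" if "x \<in> S" for x
    using has_derivative_diff[OF
        has_derivative_partial[OF smooth_on_differentiable[OF assms(3) that]]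
        has_derivative_quadratic[of k 0 h x, OF sym]]
      df[OF that]
    by (auto intro: has_derivative_at_withinI simp: mult.commute)
  from has_derivative_zero_constant[OF \<open>convex S\<close> this] obtain c where
    "\<And>x. x \<in> S \<Longrightarrow> f x - ?q x = c" by blast
  then show ?thesis by (intro exI[of _ c]) (auto simp: algebra_simps)
qed

lemma affine_if_partials_constant:
  fixes f :: "real^3 \<Rightarrow> real"
  assumes "open S" "convex S" "smooth_on S f" "\<And>x i. x \<in> S \<Longrightarrow> partial i f x = h i"
  shows "\<exists>c. \<forall>y\<in>S. f y = c + (\<Sum>a\<in>UNIV. h a * y $ a)"
proof -
  have "\<exists>c. \<forall>y\<in>S. f y =
    c + (\<Sum>a\<in>UNIV. h a * y $ a) + (\<Sum>a\<in>UNIV. \<Sum>b\<in>UNIV. (\<lambda>_ _. 0) a b * y $ a * y $ b) / 2"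
    by (rule quadratic_if_partials_affine[OF assms(1-3)]) (simp_all add: assms(4))
  then show ?thesis by simp
qed

text \<open>Integrating three times: the second partials are constant and equal their values at
  \<open>x0\<close>, the first partials are affine, and \<open>f\<close> is quadratic.\<close>

lemma quadratic_if_third_partials_zero:
  fixes f :: "real^3 \<Rightarrow> real"
  assumes S: "open S" "convex S" and x0: "x0 \<in> S" and f: "smooth_on S f"
    and zero: "\<And>x i j l. x \<in> S \<Longrightarrow> partial i (partial j (partial l f)) x = 0"
  shows "\<exists>c h. \<forall>y\<in>S. f y = c + (\<Sum>a\<in>UNIV. h a * y $ a) +
    (\<Sum>a\<in>UNIV. \<Sum>b\<in>UNIV. partial b (partial a f) x0 * y $ a * y $ b) / 2"
proof -
  note sm = smooth_on_partial
  have const: "partial j (partial l f) x = partial j (partial l f) x0" if "x \<in> S" for x j l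
  proof -
    have "\<exists>c. \<forall>y\<in>S. partial j (partial l f) y = c + (\<Sum>a\<in>UNIV. 0 * y $ a)"
      by (rule affine_if_partials_constant[OF S sm[OF sm[OF f]]]) (rule zero)
    then show ?thesis using that x0 by auto
  qed
  have "\<exists>c. \<forall>y\<in>S. partial l f y = c + (\<Sum>b\<in>UNIV. partial b (partial l f) x0 * y $ b)" for l
    by (rule affine_if_partials_constant[OF S sm[OF f]]) (rule const)
  then obtain h where h:
    "\<And>l y. y \<in> S \<Longrightarrow> partial l f y = h l + (\<Sum>b\<in>UNIV. partial b (partial l f) x0 * y $ b)"
    by metis
  have "\<exists>c. \<forall>y\<in>S. f y = c + (\<Sum>a\<in>UNIV. h a * y $ a) +
    (\<Sum>a\<in>UNIV. \<Sum>b\<in>UNIV. partial b (partial a f) x0 * y $ a * y $ b) / 2"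
    by (rule quadratic_if_partials_affine[OF S f]) (rule partial_commute[OF f S(1) x0], rule h)
  then show ?thesis by blast
qed

section \<open>Linearity of partial derivatives and closure of smooth functions\<close>

lemma partial_add:
  assumes "f differentiable (at x)" "g differentiable (at x)"
  shows "partial i (\<lambda>y. f y + g y) x = partial i f x + partial i g x"
  using assms[unfolded frechet_derivative_works]
  by (subst partial_eqI[OF has_derivative_add]) (auto simp: partial_def)

lemma partial_cmult:
  fixes f :: "real^3 \<Rightarrow> real"
  assumes "f differentiable (at x)"
  shows "partial i (\<lambda>y. c * f y) x = c * partial i f x"
  using assms[unfolded frechet_derivative_works]
  by (subst partial_eqI[OF has_derivative_mult_right]) (auto simp: partial_def)

lemma partial_const [simp]: "partial i (\<lambda>y. c) x = 0"
  by (subst partial_eqI[OF has_derivative_const]) simp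

lemma partial_sum:
  assumes "\<And>a. f a differentiable (at x)"
  shows "partial i (\<lambda>y. \<Sum>a\<in>A. f a y) x = (\<Sum>a\<in>A. partial i (f a) x)"
proof -
  have "(f a has_derivative frechet_derivative (f a) (at x)) (at x)" for a
    using assms frechet_derivative_works by blast
  then have "((\<lambda>y. \<Sum>a\<in>A. f a y) has_derivative
      (\<lambda>h. \<Sum>a\<in>A. frechet_derivative (f a) (at x) h)) (at x)"
    by (rule has_derivative_sum)
  from partial_eqI[OF this] show ?thesis
    by (simp add: partial_def)
qed

lemma smooth_on_add:
  assumes S: "open S" and "smooth_on S f" "smooth_on S g"
  shows "smooth_on S (\<lambda>x. f x + g x)"
proof -
  have "Ck_on k S (\<lambda>x. f x + g x)" if "smooth_on S f" "smooth_on S g" for k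
    using that
  proof (induction k arbitrary: f g)
    case 0
    then show ?case by (simp add: continuous_on_add smooth_on_continuous)
  next
    case (Suc k)
    have diff: "f differentiable (at x)" "g differentiable (at x)" if "x \<in> S" for x
      using Suc.prems that smooth_on_differentiable by blast+
    have "Ck_on k S (partial i (\<lambda>x. f x + g x))" for i
    proof (rule Ck_on_cong[OF S])
      show "Ck_on k S (\<lambda>x. partial i f x + partial i g x)"
        by (intro Suc.IH smooth_on_partial Suc.prems)
      show "partial i f x + partial i g x = partial i (\<lambda>x. f x + g x) x" if "x \<in> S" for x
        by (rule partial_add[OF diff[OF that], symmetric])
    qed
    then show ?case using diff by simp
  qed
  then show ?thesis using assms by (simp add: smooth_on_def)
qed

lemma smooth_on_cmult:
  fixes f :: "real^3 \<Rightarrow> real"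
  assumes S: "open S" and "smooth_on S f"
  shows "smooth_on S (\<lambda>x. c * f x)"
proof -
  have "Ck_on k S (\<lambda>x. c * f x)" if "smooth_on S f" for k
    using that
  proof (induction k arbitrary: f)
    case 0
    then show ?case by (simp add: continuous_on_mult_left smooth_on_continuous)
  next
    case (Suc k)
    have diff: "f differentiable (at x)" if "x \<in> S" for x
      using Suc.prems that smooth_on_differentiable by blast
    have "Ck_on k S (partial i (\<lambda>x. c * f x))" for i
    proof (rule Ck_on_cong[OF S])
      show "Ck_on k S (\<lambda>x. c * partial i f x)"
        by (intro Suc.IH smooth_on_partial Suc.prems)
      show "c * partial i f x = partial i (\<lambda>x. c * f x) x" if "x \<in> S" for x
        by (rule partial_cmult[OF diff[OF that], symmetric])
    qed
    then show ?case using diff by simp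
  qed
  then show ?thesis using assms by (simp add: smooth_on_def)
qed

lemma smooth_on_zero: "smooth_on S (\<lambda>x. 0 :: real)"
proof -
  have z: "partial i (\<lambda>x. 0 :: real) = (\<lambda>x. 0)" for i
    by (rule ext) simp
  have "Ck_on k S (\<lambda>x. 0 :: real)" for k
    by (induction k) (simp_all add: z)
  then show ?thesis by (simp add: smooth_on_def)
qed

lemma smooth_on_sum:
  fixes f :: "'b \<Rightarrow> real^3 \<Rightarrow> real"
  assumes S: "open S" and "\<And>a. smooth_on S (f a)"
  shows "smooth_on S (\<lambda>x. \<Sum>a\<in>A. f a x)"
proof (induction A rule: infinite_finite_induct)
  case (insert a A)
  then show ?case using smooth_on_add[OF S assms(2)] by simp
qed (simp_all add: smooth_on_zero)

section \<open>The equilibrium equations in terms of derivatives of the strain\<close>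

context
  fixes S :: "(real^3) set" and u :: "real^3 \<Rightarrow> real^3"
  assumes S: "open S" and u: "smooth_on S u"
begin

lemma smooth_on_strain: "smooth_on S (strain u l m)"
proof -
  have "smooth_on S (\<lambda>x. 1 / 2 * (partial m (\<lambda>y. u y $ l) x + partial l (\<lambda>y. u y $ m) x))"
    by (intro smooth_on_cmult smooth_on_add smooth_on_partial smooth_on_component S u)
  also have "(\<lambda>x. 1 / 2 * (partial m (\<lambda>y. u y $ l) x + partial l (\<lambda>y. u y $ m) x)) = strain u l m"
    by (simp add: strain_def fun_eq_iff)
  finally show ?thesis .
qed

lemma partial_strain:
  assumes "x \<in> S"
  shows "partial j (strain u l m) x =
    (partial j (partial m (\<lambda>y. u y $ l)) x + partial j (partial l (\<lambda>y. u y $ m)) x) / 2"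
proof -
  \<comment> \<open>Halving is written as multiplication by 1/2 so that \<open>partial_cmult\<close>
    applies; the deleted simp rule would undo this form.\<close>
  have "strain u l m = (\<lambda>x. 1 / 2 * (partial m (\<lambda>y. u y $ l) x + partial l (\<lambda>y. u y $ m) x))"
    by (simp add: strain_def fun_eq_iff)
  then show ?thesis
    by (simp add: partial_cmult partial_add smooth_on_differentiable[OF _ assms]
        smooth_on_add smooth_on_partial smooth_on_component S u del: times_divide_eq_left)
qed

lemma partial_partial_strain:
  assumes "x \<in> S"
  shows "partial k (partial j (strain u l m)) x =
    (partial k (partial j (partial m (\<lambda>y. u y $ l))) x +
     partial k (partial j (partial l (\<lambda>y. u y $ m))) x) / 2"
proof -
  have "partial k (partial j (strain u l m)) x = partial k
     (\<lambda>x. 1 / 2 * (partial j (partial m (\<lambda>y. u y $ l)) x + partial j (partial l (\<lambda>y. u y $ m)) x)) x"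
    by (rule partial_cong[OF S assms]) (simp add: partial_strain)
  then show ?thesis
    by (simp add: partial_cmult partial_add smooth_on_differentiable[OF _ assms]
        smooth_on_add smooth_on_partial smooth_on_component S u del: times_divide_eq_left)
qed

lemma partial_double_sum:
  fixes f :: "3 \<Rightarrow> 3 \<Rightarrow> real^3 \<Rightarrow> real"
  assumes "x \<in> S" and f: "\<And>l m. smooth_on S (f l m)"
  shows "partial j (\<lambda>x. \<Sum>l\<in>UNIV. \<Sum>m\<in>UNIV. c l m * f l m x) x =
    (\<Sum>l\<in>UNIV. \<Sum>m\<in>UNIV. c l m * partial j (f l m) x)"
  by (simp add: partial_sum partial_cmult smooth_on_differentiable[OF _ assms(1)] smooth_on_sum
      smooth_on_cmult S f)

lemma partial_triple_sum:
  fixes f :: "3 \<Rightarrow> 3 \<Rightarrow> 3 \<Rightarrow> real^3 \<Rightarrow> real"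
  assumes "x \<in> S" and f: "\<And>l m n. smooth_on S (f l m n)"
  shows "partial j (\<lambda>x. \<Sum>l\<in>UNIV. \<Sum>m\<in>UNIV. \<Sum>n\<in>UNIV. c l m n * f l m n x) x =
    (\<Sum>l\<in>UNIV. \<Sum>m\<in>UNIV. \<Sum>n\<in>UNIV. c l m n * partial j (f l m n) x)"
  by (simp add: partial_sum partial_cmult smooth_on_differentiable[OF _ assms(1)] smooth_on_sum
      smooth_on_cmult S f)

text \<open>Stress, hyper-stress and their derivatives share this shape: constants times strain
  terms plus constants times strain-gradient terms.\<close>

lemma partial_constitutive:
  fixes f :: "3 \<Rightarrow> 3 \<Rightarrow> real^3 \<Rightarrow> real" and g :: "3 \<Rightarrow> 3 \<Rightarrow> 3 \<Rightarrow> real^3 \<Rightarrow> real"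
  assumes x: "x \<in> S" and f: "\<And>l m. smooth_on S (f l m)" and g: "\<And>l m n. smooth_on S (g l m n)"
  shows "partial j (\<lambda>x. (\<Sum>l\<in>UNIV. \<Sum>m\<in>UNIV. c l m * f l m x) +
      (\<Sum>l\<in>UNIV. \<Sum>m\<in>UNIV. \<Sum>n\<in>UNIV. d l m n * g l m n x)) x =
    (\<Sum>l\<in>UNIV. \<Sum>m\<in>UNIV. c l m * partial j (f l m) x) +
    (\<Sum>l\<in>UNIV. \<Sum>m\<in>UNIV. \<Sum>n\<in>UNIV. d l m n * partial j (g l m n) x)"
  by (subst partial_add; (intro smooth_on_differentiable[OF _ x] smooth_on_sum smooth_on_cmult S f g)?)
    (simp add: partial_double_sum[OF x f] partial_triple_sum[OF x g])

lemma partial_stress: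
  assumes x: "x \<in> S"
  shows "partial j (stress mtl u i j) x =
    (\<Sum>l\<in>UNIV. \<Sum>m\<in>UNIV. Cten mtl i j l m * partial j (strain u l m) x) +
    (\<Sum>l\<in>UNIV. \<Sum>m\<in>UNIV. \<Sum>n\<in>UNIV. Mten mtl i j l m n * partial j (partial n (strain u l m)) x)"
proof -
  have "stress mtl u i j = (\<lambda>x.
     (\<Sum>l\<in>UNIV. \<Sum>m\<in>UNIV. Cten mtl i j l m * strain u l m x) +
     (\<Sum>l\<in>UNIV. \<Sum>m\<in>UNIV. \<Sum>n\<in>UNIV. Mten mtl i j l m n * partial n (strain u l m) x))"
    by (simp add: stress_def fun_eq_iff)
  then show ?thesis
    by (simp only: partial_constitutive[OF x smooth_on_strain smooth_on_partial[OF smooth_on_strain]])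
qed

lemma partial_partial_hyper_stress:
  assumes x: "x \<in> S"
  shows "partial k (partial j (hyper_stress mtl u i j k)) x =
    (\<Sum>l\<in>UNIV. \<Sum>m\<in>UNIV. Mten mtl l m i j k * partial k (partial j (strain u l m)) x) +
    (\<Sum>l\<in>UNIV. \<Sum>m\<in>UNIV. \<Sum>n\<in>UNIV.
      Aten mtl i j k l m n * partial k (partial j (partial n (strain u l m))) x)"
proof -
  have h: "hyper_stress mtl u i j k = (\<lambda>x.
     (\<Sum>l\<in>UNIV. \<Sum>m\<in>UNIV. Mten mtl l m i j k * strain u l m x) +
     (\<Sum>l\<in>UNIV. \<Sum>m\<in>UNIV. \<Sum>n\<in>UNIV. Aten mtl i j k l m n * partial n (strain u l m) x))"
    by (simp add: hyper_stress_def fun_eq_iff)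
  \<comment> \<open>The formula for the inner derivative holds throughout the open set
    \<open>S\<close>, so it may be substituted below the outer derivative.\<close>
  have "partial k (partial j (hyper_stress mtl u i j k)) x = partial k (\<lambda>x.
     (\<Sum>l\<in>UNIV. \<Sum>m\<in>UNIV. Mten mtl l m i j k * partial j (strain u l m) x) +
     (\<Sum>l\<in>UNIV. \<Sum>m\<in>UNIV. \<Sum>n\<in>UNIV. Aten mtl i j k l m n * partial j (partial n (strain u l m)) x)) x"
    unfolding h
    by (rule partial_cong[OF S x])
      (simp only: partial_constitutive smooth_on_strain smooth_on_partial)
  also have "\<dots> = (\<Sum>l\<in>UNIV. \<Sum>m\<in>UNIV. Mten mtl l m i j k * partial k (partial j (strain u l m)) x) +
    (\<Sum>l\<in>UNIV. \<Sum>m\<in>UNIV. \<Sum>n\<in>UNIV.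
      Aten mtl i j k l m n * partial k (partial j (partial n (strain u l m))) x)"
    by (rule partial_constitutive[OF x]) (intro smooth_on_strain smooth_on_partial)+
  finally show ?thesis .
qed

end

section \<open>The symmetry groups\<close>

definition swap12 :: "3 \<Rightarrow> 3" where
  "swap12 i = (if i = 1 then 2 else if i = 2 then 1 else i)"

lemma swap12_simps [simp]: "swap12 1 = 2" "swap12 2 = 1" "swap12 3 = 3"
  by (simp_all add: swap12_def)

lemma swap12_swap12 [simp]: "swap12 (swap12 i) = i"
  by (simp add: swap12_def)

text \<open>Row \<open>i\<close> has the single nonzero entry \<open>s i\<close>, in column
  \<open>p i\<close>. All generators of the two groups have this form, which turns invariance of a
  tensor into an identity between individual components.\<close>

definition signed_perm :: "(3 \<Rightarrow> 3) \<Rightarrow> (3 \<Rightarrow> real) \<Rightarrow> real^3^3" where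
  "signed_perm p s = (\<chi> i j. s i * (if j = p i then 1 else 0))"

lemma sum_signed_perm:
  "(\<Sum>a\<in>UNIV. signed_perm p s $ i $ a * f a) = s i * f (p i)"
proof -
  have "(\<Sum>a\<in>UNIV. signed_perm p s $ i $ a * f a) = (\<Sum>a\<in>UNIV. if a = p i then s i * f a else 0)"
    by (rule sum.cong) (auto simp: signed_perm_def)
  then show ?thesis by simp
qed

lemma signed_perm_mult: "signed_perm p s ** signed_perm q t = signed_perm (q \<circ> p) (\<lambda>i. s i * t (p i))"
  by (simp add: vec_eq_iff matrix_matrix_mult_def sum_signed_perm) (simp add: signed_perm_def)

lemma signed_perm_id: "mat 1 = signed_perm id (\<lambda>_. 1)"
  by (auto simp: vec_eq_iff signed_perm_def mat_def)

text \<open>The set \<open>E\<close> prescribes which permutations occur together with which sign of the third axis;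
  this is what distinguishes \<open>\<D>\<^sub>4\<^sup>h\<close> inside \<open>\<D>\<^sub>4 \<oplus> \<Z>\<^sub>2\<^sup>c\<close>.\<close>

definition signed_perms :: "((3 \<Rightarrow> 3) \<times> real) set \<Rightarrow> (real^3^3) set" where
  "signed_perms E = {signed_perm p s | p s. (p, s 3) \<in> E \<and> (p = id \<or> p = swap12) \<and> (\<forall>i. s i * s i = 1)}"

lemma signed_permsI:
  "(p, s 3) \<in> E \<Longrightarrow> p = id \<or> p = swap12 \<Longrightarrow> (\<And>i. s i * s i = 1) \<Longrightarrow> signed_perm p s \<in> signed_perms E"
  unfolding signed_perms_def by blast

text \<open>Both permutations are involutions, so the inverse of \<open>signed_perm p s\<close> is
  \<open>signed_perm p (s \<circ> p)\<close>. Both fix the third axis, so the third signs multiply,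
  and closure reduces to closure of the pairs in \<open>E\<close>.\<close>

lemma subgroup_signed_perms:
  assumes one: "(id, 1) \<in> E"
    and mult: "\<And>p x q y. (p, x) \<in> E \<Longrightarrow> (q, y) \<in> E \<Longrightarrow> (q \<circ> p, x * y) \<in> E"
  shows "subgroup (signed_perms E) O3"
proof -
  have p3: "p 3 = 3" "p (p i) = i" if "p = id \<or> p = swap12" for p i
    using that by auto
  have inverse: "signed_perm p (s \<circ> p) ** signed_perm p s = mat 1"
      "signed_perm p s ** signed_perm p (s \<circ> p) = mat 1"
    if "p = id \<or> p = swap12" "\<And>i. s i * s i = 1" for p s
    unfolding signed_perm_mult signed_perm_id
    by (rule arg_cong2[where f = signed_perm]; simp add: fun_eq_iff p3[OF that(1)] that(2))+
  have orth: "signed_perm p s \<in> carrier O3"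
    if "p = id \<or> p = swap12" "\<And>i. s i * s i = 1" for p s
  proof -
    have "transpose (signed_perm p s) = signed_perm p (s \<circ> p)"
      using that by (auto simp: vec_eq_iff signed_perm_def transpose_def)
    then show ?thesis
      using inverse[OF that] by (simp add: O3_def orthogonal_matrix_def)
  qed
  show ?thesis
  proof (rule group.subgroupI[OF group_O3])
    show "signed_perms E \<subseteq> carrier O3"
      using orth unfolding signed_perms_def by blast
    have "mat 1 \<in> signed_perms E"
      unfolding signed_perm_id by (rule signed_permsI) (simp_all add: one)
    then show "signed_perms E \<noteq> {}" by blast
  next
    fix Q assume "Q \<in> signed_perms E"
    then obtain p s where Q: "Q = signed_perm p s" "(p, s 3) \<in> E" "p = id \<or> p = swap12"
      "\<And>i. s i * s i = 1"
      unfolding signed_perms_def by blast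
    have "inv\<^bsub>O3\<^esub> Q = signed_perm p (s \<circ> p)"
    proof (rule group.inv_equality[OF group_O3])
      show "signed_perm p (s \<circ> p) \<otimes>\<^bsub>O3\<^esub> Q = \<one>\<^bsub>O3\<^esub>"
        using inverse[OF Q(3,4)] by (simp add: O3_def Q(1))
    qed (use orth Q in simp_all)
    also have "\<dots> \<in> signed_perms E"
      using Q p3[OF Q(3)] by (intro signed_permsI) simp_all
    finally show "inv\<^bsub>O3\<^esub> Q \<in> signed_perms E" .
  next
    fix Q P assume "Q \<in> signed_perms E" "P \<in> signed_perms E"
    then obtain p s q t where Q: "Q = signed_perm p s" "(p, s 3) \<in> E" "p = id \<or> p = swap12"
      "\<And>i. s i * s i = 1"
      and P: "P = signed_perm q t" "(q, t 3) \<in> E" "q = id \<or> q = swap12"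
      "\<And>i. t i * t i = 1"
      unfolding signed_perms_def by blast
    have sq: "s i * t j * (s i * t j) = 1" for i j
      using Q(4)[of i] P(4)[of j] by (simp add: algebra_simps)
    have "signed_perm (q \<circ> p) (\<lambda>i. s i * t (p i)) \<in> signed_perms E"
      using mult[OF Q(2) P(2)] p3[OF Q(3)] p3[OF P(3)] Q(3) P(3) sq
      by (intro signed_permsI) auto
    then show "Q \<otimes>\<^bsub>O3\<^esub> P \<in> signed_perms E"
      by (simp add: O3_def Q(1) P(1) signed_perm_mult)
  qed
qed

lemma rot_e3_signed_perm: "rot_e3 = signed_perm swap12 (\<lambda>i. if i = 1 then -1 else 1)"
  and rot_e1_signed_perm: "rot_e1 = signed_perm id (\<lambda>i. if i = 1 then 1 else -1)"
  and refl_e1_signed_perm: "refl_e1 = signed_perm id (\<lambda>i. if i = 1 then -1 else 1)"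
  and uminus_signed_perm: "- signed_perm p s = signed_perm p (\<lambda>i. - s i)"
  by (simp_all add: vec_eq_iff forall_3 signed_perm_def rot_e3_def rot_e1_def refl_e1_def swap12_def)

text \<open>The generators lie in a subgroup of \<open>O3\<close>, hence so does all they generate.
  Here both permutations occur with either sign of the third axis.\<close>

lemma D4_Z2c_subset: "D4_Z2c \<subseteq> signed_perms ({id, swap12} \<times> {1, -1})"
proof -
  let ?H = "signed_perms ({id, swap12} \<times> {1, -1 :: real})"
  have sw: "swap12 \<circ> swap12 = id"
    by (simp add: fun_eq_iff)
  have H: "subgroup ?H O3"
    by (rule subgroup_signed_perms) (auto simp: sw)
  have "rot_e3 \<in> ?H" "rot_e1 \<in> ?H" "- mat 1 \<in> ?H"
    unfolding rot_e3_signed_perm rot_e1_signed_perm signed_perm_id uminus_signed_perm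
    by (rule signed_permsI; simp)+
  then show ?thesis
    unfolding D4_Z2c_def D4_def
    by (intro group.generate_subgroup_incl[OF group_O3 _ H] Un_least) auto
qed

text \<open>\<open>refl_e1\<close> preserves the third axis, whereas \<open>- rot_e3\<close>
  exchanges the first two axes and reverses the third. The correlation between permutation and third
  sign persists under products.\<close>

lemma D4h_subset: "D4h \<subseteq> signed_perms {(id, 1), (swap12, -1)}"
proof -
  let ?H = "signed_perms {(id, 1), (swap12, -1 :: real)}"
  have sw: "swap12 \<circ> swap12 = id"
    by (simp add: fun_eq_iff)
  have H: "subgroup ?H O3"
    by (rule subgroup_signed_perms) (auto simp: sw)
  have "- rot_e3 \<in> ?H" "refl_e1 \<in> ?H"
    unfolding rot_e3_signed_perm refl_e1_signed_perm uminus_signed_perm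
    by (rule signed_permsI; simp)+
  then show ?thesis
    unfolding D4h_def
    by (intro group.generate_subgroup_incl[OF group_O3 _ H]) auto
qed

lemma rot_e3_in_D4_Z2c: "rot_e3 \<in> D4_Z2c" and rot_e1_in_D4_Z2c: "rot_e1 \<in> D4_Z2c"
  unfolding D4_Z2c_def D4_def by (auto intro!: generate.incl)

section \<open>Invariance of the test tensors\<close>

lemma sum_signed_perm4:
  "(\<Sum>a\<in>UNIV. \<Sum>b\<in>UNIV. \<Sum>c\<in>UNIV. \<Sum>d\<in>UNIV.
      signed_perm p s $ i $ a * signed_perm p s $ j $ b * signed_perm p s $ k $ c *
      signed_perm p s $ l $ d * T a b c d) =
    s i * s j * s k * s l * T (p i) (p j) (p k) (p l)"
  by (simp only: mult.assoc sum_distrib_left[symmetric] sum_signed_perm)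

lemma sum_signed_perm5:
  "(\<Sum>a\<in>UNIV. \<Sum>b\<in>UNIV. \<Sum>c\<in>UNIV. \<Sum>d\<in>UNIV. \<Sum>e\<in>UNIV.
      signed_perm p s $ i $ a * signed_perm p s $ j $ b * signed_perm p s $ k $ c *
      signed_perm p s $ l $ d * signed_perm p s $ m $ e * T a b c d e) =
    s i * s j * s k * s l * s m * T (p i) (p j) (p k) (p l) (p m)"
  by (simp only: mult.assoc sum_distrib_left[symmetric] sum_signed_perm)

text \<open>\<open>B i j\<close> is the shear modulus of the \<open>ij\<close>-plane and \<open>A\<close> the block of \<open>C\<close> coupling the diagonal
  strains. For suitable \<open>A\<close> and \<open>B\<close> these are all the tensors \<open>C\<close> of the class.\<close>

definition Cdiag :: "(3 \<Rightarrow> 3 \<Rightarrow> real) \<Rightarrow> (3 \<Rightarrow> 3 \<Rightarrow> real) \<Rightarrow> tensor4" where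
  "Cdiag A B i j k l = (if i = j \<and> k = l then A i k else 0) +
     (if i \<noteq> j \<and> (k = i \<and> l = j \<or> k = j \<and> l = i) then B i j else 0)"

text \<open>The components \<open>M\<^sub>1\<^sub>1\<^sub>1\<^sub>3\<^sub>1 = M\<^sub>1\<^sub>1\<^sub>3\<^sub>1\<^sub>1\<close> and their images under \<open>-R\<close>, which carry the opposite sign.\<close>

definition Mdiag :: "(3 \<Rightarrow> real) \<Rightarrow> tensor5" where
  "Mdiag t i j k l n = (if i = j \<and> n = i \<and> (k = i \<and> l = 3 \<or> k = 3 \<and> l = i) then t i else 0)"

text \<open>In every nonzero component each index value occurs an even number of times, so the signs
  square to 1; the permutation is absorbed by the symmetry of \<open>A\<close> and \<open>B\<close>
  under \<open>swap12\<close>.\<close>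

lemma invariant_Cdiag:
  assumes "\<And>i j. A (swap12 i) (swap12 j) = A i j" "\<And>i j. B (swap12 i) (swap12 j) = B i j"
  shows "invariant4 D4_Z2c (Cdiag A B)"
  unfolding invariant4_def
proof (intro ballI allI)
  fix Q and i j k l :: 3
  assume "Q \<in> D4_Z2c"
  then obtain p s where Q: "Q = signed_perm p s" "p = id \<or> p = swap12" and s: "\<And>i. s i * s i = 1"
    using D4_Z2c_subset unfolding signed_perms_def by blast
  have p: "p i = p j \<longleftrightarrow> i = j" "A (p i) (p j) = A i j" "B (p i) (p j) = B i j" for i j
  proof -
    show "p i = p j \<longleftrightarrow> i = j"
      using Q(2) by (metis id_apply swap12_swap12)
  qed (use Q(2) assms in auto)
  have s': "s i * (s j * (s i * s j)) = 1" "s i * (s j * (s j * s i)) = 1" "s i * (s i * (s j * s j)) = 1"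
    for i j using s[of i] s[of j] by (simp_all add: algebra_simps)
  show "(\<Sum>a\<in>UNIV. \<Sum>b\<in>UNIV. \<Sum>c\<in>UNIV. \<Sum>d\<in>UNIV. 
      Q$i$a * Q$j$b * Q$k$c * Q$l$d * Cdiag A B a b c d) = Cdiag A B i j k l"
    unfolding Q(1) sum_signed_perm4 Cdiag_def p
    using s'[of i j] s'[of i k] by (auto simp: mult.assoc)
qed

text \<open>A nonzero component has the index \<open>i\<close> four times and the index 3 once, so
  the signs reduce to \<open>s 3\<close>. This is -1 exactly when the permutation is
  \<open>swap12\<close>, which the opposite values \<open>t 1\<close> and \<open>t 2\<close>
  compensate.\<close>

lemma invariant_Mdiag:
  assumes "t 3 = 0" "t 2 = - t 1"
  shows "invariant5 D4h (Mdiag t)"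
  unfolding invariant5_def
proof (intro ballI allI)
  fix Q and i j k l n :: 3
  assume "Q \<in> D4h"
  then obtain p s where Q: "Q = signed_perm p s" "p = id \<and> s 3 = 1 \<or> p = swap12 \<and> s 3 = -1"
      and s: "\<And>i. s i * s i = 1"
    using D4h_subset unfolding signed_perms_def by blast
  have p: "p i = p j \<longleftrightarrow> i = j" "p i = 3 \<longleftrightarrow> i = 3" for i j
    using Q(2) swap12_swap12 swap12_simps(3) by (metis id_apply)+
  have "s 3 * t (p i) = t i" for i
    using Q(2) assms exhaust_3[of i] by auto
  then have t: "s i * (s i * (s i * (s 3 * (s i * t (p i))))) = t i"
    "s i * (s i * (s 3 * (s i * (s i * t (p i))))) = t i" for i
    using s[of i] by (simp_all add: algebra_simps)
  show "(\<Sum>a\<in>UNIV. \<Sum>b\<in>UNIV. \<Sum>c\<in>UNIV. \<Sum>d\<in>UNIV. \<Sum>e\<in>UNIV.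
      Q$i$a * Q$j$b * Q$k$c * Q$l$d * Q$n$e * Mdiag t a b c d e) = Mdiag t i j k l n"
    unfolding Q(1) sum_signed_perm5 Mdiag_def p
    using t[of i] by (auto simp: mult.assoc)
qed

lemma Cdiag_in_class:
  assumes "\<And>i j. A (swap12 i) (swap12 j) = A i j" "\<And>i j. B (swap12 i) (swap12 j) = B i j"
    and "\<And>i j. A i j = A j i" "\<And>i j. B i j = B j i"
  shows "\<lparr>Cten = Cdiag A B, Mten = (\<lambda>_ _ _ _ _. 0), Aten = (\<lambda>_ _ _ _ _ _. 0)\<rparr> \<in> class_D4h"
proof -
  have "Cdiag A B i j k l = Cdiag A B j i k l" for i j k l
    unfolding Cdiag_def using assms(4)[of j i] by (cases "i = j") auto
  moreover have "Cdiag A B i j k l = Cdiag A B k l i j" for i j k l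
    unfolding Cdiag_def
  proof (intro arg_cong2[where f = "(+)"] if_cong refl)
    show "(i = j \<and> k = l) = (k = l \<and> i = j)"
      "(i \<noteq> j \<and> (k = i \<and> l = j \<or> k = j \<and> l = i)) = (k \<noteq> l \<and> (i = k \<and> j = l \<or> i = l \<and> j = k))"
      by blast+
    show "A i k = A k i" by (rule assms(3))
    show "B i j = B k l" if "k \<noteq> l \<and> (i = k \<and> j = l \<or> i = l \<and> j = k)"
      using that assms(4) by metis
  qed
  ultimately have "sg_material \<lparr>Cten = Cdiag A B, Mten = (\<lambda>_ _ _ _ _. 0), Aten = (\<lambda>_ _ _ _ _ _. 0)\<rparr>"
    unfolding sg_material_def sg_tensors.simps by blast
  then show ?thesis
    using invariant_Cdiag[of A B, OF assms(1,2)]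
    unfolding class_D4h_def invariant5_def invariant6_def by simp
qed

lemma Mdiag_in_class:
  assumes "t 3 = 0" "t 2 = - t 1"
  shows "\<lparr>Cten = (\<lambda>_ _ _ _. 0), Mten = Mdiag t, Aten = (\<lambda>_ _ _ _ _ _. 0)\<rparr> \<in> class_D4h"
proof -
  have "Mdiag t i j k l n = Mdiag t j i k l n" for i j k l n
    unfolding Mdiag_def by auto
  moreover have "Mdiag t i j k l n = Mdiag t i j l k n" for i j k l n
    unfolding Mdiag_def by (intro if_cong refl) blast
  ultimately have "sg_material \<lparr>Cten = (\<lambda>_ _ _ _. 0), Mten = Mdiag t, Aten = (\<lambda>_ _ _ _ _ _. 0)\<rparr>"
    unfolding sg_material_def sg_tensors.simps by blast
  then show ?thesis
    using invariant_Mdiag[OF assms]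
    unfolding class_D4h_def invariant4_def invariant6_def by simp
qed

section \<open>Universal displacement fields\<close>

text \<open>The material tensors are constant, so all derivatives fall on the strain:
  \<open>C\<close> meets its first, \<open>M\<close> its second and \<open>A\<close> its third
  derivatives.\<close>

lemma equilibrium_on_iff:
  assumes S: "open S" and u: "smooth_on S u"
  shows "equilibrium_on S mtl u \<longleftrightarrow> (\<forall>x\<in>S. \<forall>i.
    (\<Sum>j\<in>UNIV. (\<Sum>l\<in>UNIV. \<Sum>m\<in>UNIV. Cten mtl i j l m * partial j (strain u l m) x) +
      (\<Sum>l\<in>UNIV. \<Sum>m\<in>UNIV. \<Sum>n\<in>UNIV. Mten mtl i j l m n * partial j (partial n (strain u l m)) x)) -
    (\<Sum>j\<in>UNIV. \<Sum>k\<in>UNIV.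
      (\<Sum>l\<in>UNIV. \<Sum>m\<in>UNIV. Mten mtl l m i j k * partial k (partial j (strain u l m)) x) +
      (\<Sum>l\<in>UNIV. \<Sum>m\<in>UNIV. \<Sum>n\<in>UNIV.
        Aten mtl i j k l m n * partial k (partial j (partial n (strain u l m))) x)) = 0)"
  unfolding equilibrium_on_def
  by (rule ball_cong[OF refl])
    (simp only: partial_stress[OF S u] partial_partial_hyper_stress[OF S u])

section \<open>Necessity: constraints on second and third partial derivatives\<close>

lemma second_partials_if_universal:
  fixes u :: "real^3 \<Rightarrow> real^3"
  defines "D x l i j \<equiv> partial i (partial j (\<lambda>y. u y $ l)) x"
  assumes S: "open S" and u: "smooth_on S u" and univ: "universal_on S class_D4h u" and x: "x \<in> S"
  shows "D x 1 1 1 = 0" "D x 1 2 2 = 0" "D x 1 3 3 = 0" "D x 1 1 2 = 0"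
    "D x 2 1 1 = 0" "D x 2 2 2 = 0" "D x 2 3 3 = 0" "D x 2 1 2 = 0"
    "D x 3 3 3 = 0" "D x 3 1 3 = 0" "D x 3 2 3 = 0" "D x 3 1 1 + D x 3 2 2 = 0"
    "D x 1 1 3 + D x 2 2 3 = 0"
proof -
  have sym: "D x l i j = D x l j i" for l i j
    unfolding D_def by (rule partial_commute[OF smooth_on_component[OF S u] S x])
  have strain: "partial j (strain u l m) x = (D x l j m + D x m j l) / 2" for j l m
    unfolding D_def by (rule partial_strain[OF S u x])
  have main: "a11 * D x 1 1 1 + a12 * D x 2 1 2 + a13 * D x 3 1 3
       + b12 * (D x 1 2 2 + D x 2 1 2) + b13 * (D x 1 3 3 + D x 3 1 3) = 0"
    "a12 * D x 1 1 2 + a11 * D x 2 2 2 + a13 * D x 3 2 3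
       + b12 * (D x 2 1 1 + D x 1 1 2) + b13 * (D x 2 3 3 + D x 3 2 3) = 0"
    "a13 * (D x 1 1 3 + D x 2 2 3) + a33 * D x 3 3 3
       + b13 * (D x 3 1 1 + D x 1 1 3 + D x 3 2 2 + D x 2 2 3) = 0"
    for a11 a12 a13 a33 b12 b13 :: real
  proof -
    \<comment> \<open>These blocks are the tetragonal ones: axes 1 and 2 are interchangeable, which
      leaves four constants in \<open>A\<close> and two in \<open>B\<close>.\<close>
    define A where "A i j = (if i = 3 \<and> j = 3 then a33 else if i = 3 \<or> j = 3 then a13
      else if i = j then a11 else a12)" for i j :: 3
    define B where "B i j = (if i = 3 \<or> j = 3 then b13 else b12)" for i j :: 3
    have "\<lparr>Cten = Cdiag A B, Mten = (\<lambda>_ _ _ _ _. 0), Aten = (\<lambda>_ _ _ _ _ _. 0)\<rparr> \<in> class_D4h"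
      by (rule Cdiag_in_class) (auto simp: A_def B_def swap12_def)
    then have "equilibrium_on S \<lparr>Cten = Cdiag A B, Mten = (\<lambda>_ _ _ _ _. 0), Aten = (\<lambda>_ _ _ _ _ _. 0)\<rparr> u"
      using univ unfolding universal_on_def by blast
    from this[unfolded equilibrium_on_iff[OF S u], rule_format, OF x]
    have eq: "(\<Sum>j\<in>UNIV. \<Sum>l\<in>UNIV. \<Sum>m\<in>UNIV. Cdiag A B i j l m * ((D x l j m + D x m j l) / 2)) = 0" for i
      by (simp add: strain)
    note sym' = sym[of _ 2 1] sym[of _ 3 1] sym[of _ 3 2]
    show "a11 * D x 1 1 1 + a12 * D x 2 1 2 + a13 * D x 3 1 3
       + b12 * (D x 1 2 2 + D x 2 1 2) + b13 * (D x 1 3 3 + D x 3 1 3) = 0"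
      using eq[of 1] by (simp add: sum_3 Cdiag_def A_def B_def sym' algebra_simps)
    show "a12 * D x 1 1 2 + a11 * D x 2 2 2 + a13 * D x 3 2 3
       + b12 * (D x 2 1 1 + D x 1 1 2) + b13 * (D x 2 3 3 + D x 3 2 3) = 0"
      using eq[of 2] by (simp add: sum_3 Cdiag_def A_def B_def sym' algebra_simps)
    show "a13 * (D x 1 1 3 + D x 2 2 3) + a33 * D x 3 3 3
       + b13 * (D x 3 1 1 + D x 1 1 3 + D x 3 2 2 + D x 2 2 3) = 0"
      using eq[of 3] by (simp add: sum_3 Cdiag_def A_def B_def sym' algebra_simps)
  qed
  \<comment> \<open>The equations are linear in the free constants, so each coefficient is isolated
    by setting one constant to 1. The positional arguments follow the order of occurrence:
    \<open>a11 a12 a13 b12 b13\<close> in \<open>main(1)\<close>, \<open>a12 a11 a13 b12 b13\<close>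
    in \<open>main(2)\<close>, \<open>a13 a33 b13\<close> in \<open>main(3)\<close>.\<close>
  show 1: "D x 1 1 1 = 0" "D x 2 1 2 = 0" "D x 3 1 3 = 0"
    using main(1)[of 1 0 0 0 0] main(1)[of 0 1 0 0 0] main(1)[of 0 0 1 0 0] by simp_all
  show 2: "D x 1 1 2 = 0" "D x 2 2 2 = 0" "D x 3 2 3 = 0"
    using main(2)[of 1 0 0 0 0] main(2)[of 0 1 0 0 0] main(2)[of 0 0 1 0 0] by simp_all
  show "D x 1 2 2 = 0" "D x 1 3 3 = 0"
    using main(1)[of 0 0 0 1 0] main(1)[of 0 0 0 0 1] 1 by simp_all
  show "D x 2 1 1 = 0" "D x 2 3 3 = 0"
    using main(2)[of 0 0 0 1 0] main(2)[of 0 0 0 0 1] 2 by simp_all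
  show 3: "D x 3 3 3 = 0" "D x 1 1 3 + D x 2 2 3 = 0"
    using main(3)[of 0 1 0] main(3)[of 1 0 0] by simp_all
  show "D x 3 1 1 + D x 3 2 2 = 0"
    using main(3)[of 0 0 1] 3(2) by simp
qed

lemma third_partial_zero:
  assumes "open S" "x \<in> S" "\<And>y. y \<in> S \<Longrightarrow> partial j (partial l f) y = 0"
  shows "partial i (partial j (partial l f)) x = 0"
  using partial_cong[OF assms(1,2), of "partial j (partial l f)" "\<lambda>_. 0" i] assms(3) by simp

lemma third_partial_commute:
  fixes f :: "real^3 \<Rightarrow> real"
  assumes S: "open S" and f: "smooth_on S f" and x: "x \<in> S"
  shows "partial i (partial j (partial l f)) x = partial j (partial i (partial l f)) x"
    and "partial i (partial j (partial l f)) x = partial i (partial l (partial j f)) x"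
proof -
  show "partial i (partial j (partial l f)) x = partial j (partial i (partial l f)) x"
    by (rule partial_commute[OF smooth_on_partial[OF f] S x])
  show "partial i (partial j (partial l f)) x = partial i (partial l (partial j f)) x"
    by (rule partial_cong[OF S x partial_commute[OF f S]])
qed

lemma third_partials_if_universal:
  fixes u :: "real^3 \<Rightarrow> real^3"
  assumes S: "open S" and u: "smooth_on S u" and univ: "universal_on S class_D4h u" and x: "x \<in> S"
  shows "partial i (partial j (partial l (\<lambda>y. u y $ a))) x = 0"
proof -
  define T where "T a i j l = partial i (partial j (partial l (\<lambda>y. u y $ a))) x" for a i j l
  note D = second_partials_if_universal[OF S u univ]
  have sym: "T a i j l = T a j i l" "T a i j l = T a i l j" for a i j l
    unfolding T_def
    using third_partial_commute[OF S smooth_on_component[OF S u, of a] x] by blast+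
  note sym' = sym(1)[of _ 2 1] sym(1)[of _ 3 1] sym(1)[of _ 3 2]
    sym(2)[of _ _ 2 1] sym(2)[of _ _ 3 1] sym(2)[of _ _ 3 2]
  have T0: "T 1 i 1 1 = 0" "T 1 i 2 2 = 0" "T 1 i 3 3 = 0" "T 1 i 1 2 = 0"
    "T 2 i 1 1 = 0" "T 2 i 2 2 = 0" "T 2 i 3 3 = 0" "T 2 i 1 2 = 0"
    "T 3 i 3 3 = 0" "T 3 i 1 3 = 0" "T 3 i 2 3 = 0" for i
    unfolding T_def by (rule third_partial_zero[OF S x]; rule D; assumption)+
  \<comment> \<open>The relation \<open>D(12)\<close>, harmonicity of the third component in the
    first two variables, is differentiated once more.\<close>
  have harm: "T 3 i 1 1 + T 3 i 2 2 = 0" for i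
  proof -
    note diff = smooth_on_differentiable[OF smooth_on_partial[OF smooth_on_partial[OF smooth_on_component[OF S u]]] x]
    have "T 3 i 1 1 + T 3 i 2 2 =
      partial i (\<lambda>y. partial 1 (partial 1 (\<lambda>y. u y $ 3)) y + partial 2 (partial 2 (\<lambda>y. u y $ 3)) y) x"
      unfolding T_def by (rule partial_add[symmetric]) (rule diff)+
    also have "\<dots> = partial i (\<lambda>_. 0) x"
      by (rule partial_cong[OF S x]) (rule D(12))
    finally show ?thesis by simp
  qed
  define t :: "3 \<Rightarrow> real" where "t i = (if i = 1 then 1 else if i = 2 then -1 else 0)" for i
  have "\<lparr>Cten = (\<lambda>_ _ _ _. 0), Mten = Mdiag t, Aten = (\<lambda>_ _ _ _ _ _. 0)\<rparr> \<in> class_D4h"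
    by (rule Mdiag_in_class) (simp_all add: t_def)
  then have "equilibrium_on S \<lparr>Cten = (\<lambda>_ _ _ _. 0), Mten = Mdiag t, Aten = (\<lambda>_ _ _ _ _ _. 0)\<rparr> u"
    using univ unfolding universal_on_def by blast
  from this[unfolded equilibrium_on_iff[OF S u], rule_format, OF x]
  have eq: "(\<Sum>j\<in>UNIV. \<Sum>l\<in>UNIV. \<Sum>m\<in>UNIV. \<Sum>n\<in>UNIV. Mdiag t i j l m n * ((T l j n m + T m j n l) / 2)) -
      (\<Sum>j\<in>UNIV. \<Sum>k\<in>UNIV. \<Sum>l\<in>UNIV. \<Sum>m\<in>UNIV. Mdiag t l m i j k * ((T l k j m + T m k j l) / 2)) = 0" for i
    by (simp add: partial_partial_strain[OF S u x] T_def)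
  \<comment> \<open>The other terms of the first equation are multiples of \<open>T 1 1 1 3\<close>,
    which equals \<open>T 1 3 1 1\<close> and vanishes. The second equation is analogous.\<close>
  have "T 3 1 1 1 = 0"
    using eq[of 1] by (simp add: sum_3 Mdiag_def t_def T0 sym' field_simps)
  moreover have "T 3 2 2 2 = 0"
    using eq[of 2] by (simp add: sum_3 Mdiag_def t_def T0 sym' field_simps)
  \<comment> \<open>Harmonicity gives \<open>T 3 1 2 2\<close> as the negative of
    \<open>T 3 1 1 1\<close>, and \<open>T 3 1 1 2 = T 3 2 1 1\<close> as the negative of
    \<open>T 3 2 2 2\<close>.\<close>
  ultimately have T1: "T 3 1 1 1 = 0" "T 3 2 2 2 = 0" "T 3 1 2 2 = 0" "T 3 1 1 2 = 0"
    using harm[of 1] harm[of 2] sym' by simp_all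
  \<comment> \<open>By symmetry these are derivatives in direction 3 of second partials that vanish
    on \<open>S\<close>.\<close>
  have T2: "T a 1 1 3 = 0" "T a 1 2 3 = 0" "T a 2 2 3 = 0" if "a \<noteq> 3" for a
    using that exhaust_3[of a] T0(1,2,4)[of 3] T0(5,6,8)[of 3] sym by metis+
  have "\<forall>a i j l. T a i j l = 0"
    unfolding forall_3 by (simp add: T0 T1 T2 sym')
  then show ?thesis by (simp add: T_def)
qed

section \<open>Sufficiency: quadratic fields with the required second partial derivatives\<close>

lemma invariant4_signed_perm:
  assumes "invariant4 G T" "signed_perm p s \<in> G"
  shows "T i j k l = s i * s j * s k * s l * T (p i) (p j) (p k) (p l)"
  using assms(1)[unfolded invariant4_def, rule_format, OF assms(2), of i j k l]
  unfolding sum_signed_perm4 by simp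

lemma partials_quadratic:
  fixes f :: "real^3 \<Rightarrow> real"
  assumes S: "open S" and sym: "\<And>a b. k a b = k b a"
    and f: "\<And>y. y \<in> S \<Longrightarrow>
      f y = c + (\<Sum>a\<in>UNIV. h a * y $ a) + (\<Sum>a\<in>UNIV. \<Sum>b\<in>UNIV. k a b * y $ a * y $ b) / 2"
    and x: "x \<in> S"
  shows "partial j (partial i f) x = k i j"
    and "partial l (partial j (partial i f)) x = 0"
proof -
  have second: "partial j (partial i f) y = k i j" if "y \<in> S" for y
    by (rule partial_affine[OF S that]) (rule partial_quadratic[OF S _ sym f])
  from second[OF x] show "partial j (partial i f) x = k i j" .
  have "partial l (partial j (partial i f)) x = partial l (\<lambda>_. k i j) x"
    by (rule partial_cong[OF S x second])
  then show "partial l (partial j (partial i f)) x = 0" by simp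
qed

text \<open>\<open>K l\<close> is the matrix of second partials of component \<open>l\<close>. On a
  quadratic field the terms with \<open>M\<close> and \<open>A\<close> involve partials of order
  three and four and vanish, so only the action of \<open>C\<close> on \<open>K\<close> has to be
  balanced.\<close>

lemma universal_if_quadratic:
  fixes K :: "3 \<Rightarrow> 3 \<Rightarrow> 3 \<Rightarrow> real"
  assumes S: "open S" and u: "smooth_on S u"
    and sym: "\<And>l a b. K l a b = K l b a"
    and quad: "\<And>y l. y \<in> S \<Longrightarrow> u y $ l =
      c l + (\<Sum>a\<in>UNIV. h l a * y $ a) + (\<Sum>a\<in>UNIV. \<Sum>b\<in>UNIV. K l a b * y $ a * y $ b) / 2"
    and K: "K 1 1 1 = 0" "K 1 2 2 = 0" "K 1 3 3 = 0" "K 1 1 2 = 0"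
    "K 2 1 1 = 0" "K 2 2 2 = 0" "K 2 3 3 = 0" "K 2 1 2 = 0"
    "K 3 3 3 = 0" "K 3 1 3 = 0" "K 3 2 3 = 0" "K 3 1 1 + K 3 2 2 = 0" "K 1 1 3 + K 2 2 3 = 0"
  shows "universal_on S class_D4h u"
  unfolding universal_on_def equilibrium_on_iff[OF S u]
proof (intro ballI allI)
  fix mtl x and i :: 3
  assume mtl: "mtl \<in> class_D4h" and x: "x \<in> S"
  have e1: "partial j (strain u l m) y = (K l m j + K m l j) / 2" if "y \<in> S" for j l m y
    using partial_strain[OF S u that] partials_quadratic(1)[OF S sym quad that] by simp
  have e2: "partial k (partial j (strain u l m)) y = 0" if "y \<in> S" for j k l m y
    using partial_partial_strain[OF S u that] partials_quadratic(2)[OF S sym quad that] by simp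
  have e3: "partial n (partial k (partial j (strain u l m))) x = 0" for j k l m n
    using partial_cong[OF S x e2, where i = n] by simp
  define C where "C = Cten mtl"
  have inv: "invariant4 D4_Z2c C"
    using mtl by (simp add: class_D4h_def C_def)
  note R = invariant4_signed_perm[OF inv rot_e3_in_D4_Z2c[unfolded rot_e3_signed_perm]]
  \<comment> \<open>The rotation by \<pi> about the first axis negates every component with an odd
    number of indices different from 1.\<close>
  have C0: "C i j k l = 0" if "(if i = 1 then 1 else -1) * (if j = 1 then 1 else -1) *
      (if k = 1 then 1 else -1) * (if l = 1 then 1 else -1 :: real) = -1" for i j k l
    using invariant4_signed_perm[OF inv rot_e1_in_D4_Z2c[unfolded rot_e1_signed_perm], of i j k l] that
    by simp
  \<comment> \<open>Applying \<open>rot_e3\<close> twice gives the rotation by \<pi> about the third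
    axis; its sign on axis \<open>i\<close> is \<open>r i * r (swap12 i)\<close>. Together with
    \<open>C0\<close>, only components in which each index value occurs an even number of times
    survive.\<close>
  have C0': "C i j k l = 0" if "(if i = 3 then 1 else -1) * (if j = 3 then 1 else -1) *
      (if k = 3 then 1 else -1) * (if l = 3 then 1 else -1 :: real) = -1" for i j k l
  proof -
    define r :: "3 \<Rightarrow> real" where "r i = (if i = 1 then -1 else 1)" for i
    have "r i * r (swap12 i) = (if i = 3 then 1 else -1)" for i
      using exhaust_3[of i] by (auto simp: r_def)
    then have "(r i * r (swap12 i)) * (r j * r (swap12 j)) * (r k * r (swap12 k)) * (r l * r (swap12 l)) = -1"
      using that by simp
    moreover have "C i j k l =
        (r i * r (swap12 i)) * (r j * r (swap12 j)) * (r k * r (swap12 k)) * (r l * r (swap12 l)) * C i j k l"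
      using R[of i j k l] R[of "swap12 i" "swap12 j" "swap12 k" "swap12 l"]
      by (simp add: r_def[symmetric] mult_ac)
    ultimately show ?thesis by simp
  qed
  have C1: "C 3 3 1 1 = C 3 3 2 2" "C 3 1 1 3 = C 3 2 2 3" "C 3 1 3 1 = C 3 2 3 2"
    using R[of 3 3 1 1] R[of 3 1 1 3] R[of 3 1 3 1] by simp_all
  note sym' = sym[of _ 2 1] sym[of _ 3 1] sym[of _ 3 2]
  have K': "K 2 2 3 = - K 1 1 3" "K 3 2 2 = - K 3 1 1"
    using K(12,13) by linarith+
  \<comment> \<open>For \<open>i = 1\<close> and \<open>i = 2\<close> the surviving components
    multiply second partials that vanish individually; for \<open>i = 3\<close> the contributions of
    axes 1 and 2 cancel by \<open>C1\<close> and \<open>K'\<close>.\<close>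
  have "(\<Sum>j\<in>UNIV. \<Sum>l\<in>UNIV. \<Sum>m\<in>UNIV. C i j l m * ((K l m j + K m l j) / 2)) = 0"
  proof -
    have "i = 1 \<or> i = 2 \<or> i = 3" by (rule exhaust_3)
    then show ?thesis
      by (elim disjE; simp add: sum_3 C0 C0' C1 sym' K(1-11) K' field_simps)
  qed
  then show "(\<Sum>j\<in>UNIV. (\<Sum>l\<in>UNIV. \<Sum>m\<in>UNIV. Cten mtl i j l m * partial j (strain u l m) x) +
      (\<Sum>l\<in>UNIV. \<Sum>m\<in>UNIV. \<Sum>n\<in>UNIV. Mten mtl i j l m n * partial j (partial n (strain u l m)) x)) -
    (\<Sum>j\<in>UNIV. \<Sum>k\<in>UNIV.
      (\<Sum>l\<in>UNIV. \<Sum>m\<in>UNIV. Mten mtl l m i j k * partial k (partial j (strain u l m)) x) +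
      (\<Sum>l\<in>UNIV. \<Sum>m\<in>UNIV. \<Sum>n\<in>UNIV.
        Aten mtl i j k l m n * partial k (partial j (partial n (strain u l m))) x)) = 0"
    using x by (simp add: e1 e2 e3 C_def)
qed

theorem proposition3p11:
  fixes \<Omega> :: "(real^3) set" and u :: "real^3 \<Rightarrow> real^3"
  assumes "open \<Omega>" and "convex \<Omega>" and "\<Omega> \<noteq> {}"
    and "smooth_on \<Omega> u"
  shows "universal_on \<Omega> class_D4h u \<longleftrightarrow>
    (\<exists>v w. homogeneous_on \<Omega> v \<and>
       (\<exists>c1 c2 c3 d1 d2 d3 d4 d5 :: real. \<forall>x\<in>\<Omega>.
          w x = vector
            [c1 * x$2 * x$3 + c2 * x$1 * x$3,
             - c2 * x$2 * x$3 + c3 * x$1 * x$3,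
             d1 + d2 * x$1 + d3 * x$2 + d4 * x$1 * x$2 + d5 * ((x$2)^2 - (x$1)^2)]) \<and>
       (\<forall>x\<in>\<Omega>. u x = v x + w x))"
proof
  assume univ: "universal_on \<Omega> class_D4h u"
  obtain x0 where x0: "x0 \<in> \<Omega>"
    using assms(3) by blast
  define K where "K l i j = partial i (partial j (\<lambda>y. u y $ l)) x0" for l i j
  note K = second_partials_if_universal[OF assms(1,4) univ x0, folded K_def]
  have sym: "K l i j = K l j i" for l i j
    unfolding K_def by (rule partial_commute[OF smooth_on_component[OF assms(1,4)] assms(1) x0])
  note sym' = sym[of _ 2 1] sym[of _ 3 1] sym[of _ 3 2]
  have K': "K 2 2 3 = - K 1 1 3" "K 3 2 2 = - K 3 1 1"
    using K(12,13) by linarith+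
  have "\<exists>c h. \<forall>y\<in>\<Omega>. u y $ l = c + (\<Sum>a\<in>UNIV. h a * y $ a) +
    (\<Sum>a\<in>UNIV. \<Sum>b\<in>UNIV. K l b a * y $ a * y $ b) / 2" for l
    unfolding K_def
    by (rule quadratic_if_third_partials_zero[OF assms(1,2) x0 smooth_on_component[OF assms(1,4)]])
      (rule third_partials_if_universal[OF assms(1,4) univ])
  then have "\<forall>l. \<exists>c h. \<forall>y\<in>\<Omega>. u y $ l = c + (\<Sum>a\<in>UNIV. h a * y $ a) +
    (\<Sum>a\<in>UNIV. \<Sum>b\<in>UNIV. K l b a * y $ a * y $ b) / 2"
    by (rule allI)
  then obtain c h where u: "\<And>l y. y \<in> \<Omega> \<Longrightarrow> u y $ l = c l + (\<Sum>a\<in>UNIV. h l a * y $ a) +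
    (\<Sum>a\<in>UNIV. \<Sum>b\<in>UNIV. K l b a * y $ a * y $ b) / 2"
    unfolding choice_iff by blast
  define v where "v x = (\<chi> l a. h l a) *v x + (\<chi> l. c l)" for x
  \<comment> \<open>The constants are read off from the second partials at \<open>x0\<close>. Those
    of the affine part of the third component are 0, because \<open>v\<close> already carries all
    affine terms.\<close>
  define w :: "real^3 \<Rightarrow> real^3" where "w x = vector
    [K 1 2 3 * x$2 * x$3 + K 1 1 3 * x$1 * x$3,
     - K 1 1 3 * x$2 * x$3 + K 2 1 3 * x$1 * x$3,
     0 + 0 * x$1 + 0 * x$2 + K 3 1 2 * x$1 * x$2 + (- K 3 1 1 / 2) * ((x$2)^2 - (x$1)^2)]" for x
  have "homogeneous_on \<Omega> v"
    unfolding homogeneous_on_def v_def by blast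
  moreover have "u x = v x + w x" if "x \<in> \<Omega>" for x
    unfolding vec_eq_iff forall_3
    by (simp add: u[OF that] v_def w_def matrix_vector_mult_def sum_3 sym' K(1-11) K'
        power2_eq_square field_simps)
  ultimately show "\<exists>v w. homogeneous_on \<Omega> v \<and>
       (\<exists>c1 c2 c3 d1 d2 d3 d4 d5 :: real. \<forall>x\<in>\<Omega>.
          w x = vector
            [c1 * x$2 * x$3 + c2 * x$1 * x$3,
             - c2 * x$2 * x$3 + c3 * x$1 * x$3,
             d1 + d2 * x$1 + d3 * x$2 + d4 * x$1 * x$2 + d5 * ((x$2)^2 - (x$1)^2)]) \<and>
       (\<forall>x\<in>\<Omega>. u x = v x + w x)"
    using w_def by blast
next
  assume "\<exists>v w. homogeneous_on \<Omega> v \<and>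
       (\<exists>c1 c2 c3 d1 d2 d3 d4 d5 :: real. \<forall>x\<in>\<Omega>.
          w x = vector
            [c1 * x$2 * x$3 + c2 * x$1 * x$3,
             - c2 * x$2 * x$3 + c3 * x$1 * x$3,
             d1 + d2 * x$1 + d3 * x$2 + d4 * x$1 * x$2 + d5 * ((x$2)^2 - (x$1)^2)]) \<and>
       (\<forall>x\<in>\<Omega>. u x = v x + w x)"
  then obtain v w and c1 c2 c3 d1 d2 d3 d4 d5 :: real and H :: "real^3^3" and b :: "real^3" where
    v: "\<And>x. x \<in> \<Omega> \<Longrightarrow> v x = H *v x + b"
    and w: "\<And>x. x \<in> \<Omega> \<Longrightarrow> w x = vector
            [c1 * x$2 * x$3 + c2 * x$1 * x$3,
             - c2 * x$2 * x$3 + c3 * x$1 * x$3,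
             d1 + d2 * x$1 + d3 * x$2 + d4 * x$1 * x$2 + d5 * ((x$2)^2 - (x$1)^2)]"
    and u: "\<And>x. x \<in> \<Omega> \<Longrightarrow> u x = v x + w x"
    unfolding homogeneous_on_def by blast
  \<comment> \<open>These are the second partials of \<open>w\<close>; the entry
    \<open>- 2 * d5\<close> comes from the square of the first coordinate, and the square of the
    second gives its negative.\<close>
  define k13 k23 k12 k11 :: "3 \<Rightarrow> real" where
    "k13 l = (if l = 1 then c2 else if l = 2 then c3 else 0)"
    and "k23 l = (if l = 1 then c1 else if l = 2 then - c2 else 0)"
    and "k12 l = (if l = 3 then d4 else 0)"
    and "k11 l = (if l = 3 then - 2 * d5 else 0)" for l
  define K where "K l i j =
    (if i = j then (if i = 1 then k11 l else if i = 2 then - k11 l else 0)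
     else if i \<noteq> 2 \<and> j \<noteq> 2 then k13 l else if i \<noteq> 1 \<and> j \<noteq> 1 then k23 l else k12 l)" for l i j :: 3
  \<comment> \<open>The affine terms with \<open>d2\<close>, \<open>d3\<close>, and
    \<open>d1\<close> in \<open>c\<close> below, are merged into the homogeneous part.\<close>
  define h where "h l a = H $ l $ a + (if l = 3 then if a = 1 then d2 else if a = 2 then d3 else 0 else 0)"
    for l a :: 3
  define c where "c l = b $ l + (if l = 3 then d1 else 0)" for l :: 3
  note defs = K_def h_def c_def k13_def k23_def k12_def k11_def
  show "universal_on \<Omega> class_D4h u"
  proof (rule universal_if_quadratic[OF assms(1,4)])
    show "K l i j = K l j i" for l i j
      unfolding K_def by auto
    have "\<forall>l. u y $ l = c l + (\<Sum>a\<in>UNIV. h l a * y $ a) +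
        (\<Sum>a\<in>UNIV. \<Sum>b\<in>UNIV. K l a b * y $ a * y $ b) / 2" if "y \<in> \<Omega>" for y
      unfolding forall_3 u[OF that] v[OF that] w[OF that]
      by (simp add: matrix_vector_mult_def sum_3 defs power2_eq_square field_simps)
    then show "u y $ l = c l + (\<Sum>a\<in>UNIV. h l a * y $ a) +
        (\<Sum>a\<in>UNIV. \<Sum>b\<in>UNIV. K l a b * y $ a * y $ b) / 2" if "y \<in> \<Omega>" for y l
      using that by blast
  qed (simp_all add: defs)
qed

end
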